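(* Consider the multi-server speed-scaling problem described in the context with power function $P(s)=s^\alpha$ for some $\alpha\in(1,2)$. Consider the online algorithm that at every time $t$ serves, on $\min\{m,n(t)\}$ distinct servers, the $\min\{m,n(t)\}$ unfinished jobs with the shortest remaining sizes (SRPT, with migration allowed), where $n(t)$ is the number of unfinished jobs at time $t$; each busy server runs at speed $P^{-1}(n(t)/m)=(n(t)/m)^{1/\alpha}$ if $n(t)\ge m$ and at speed $P^{-1}(1)=1$ if $n(t)<m$, and idle servers run at speed $0$. Then this algorithm is $c$-competitive with $$c=3+\frac{2}{2-\alpha}.$$
   Context: There are $m$ identical servers, each of which can run at any speed $s\ge 0$ at power consumption $P(s)$; work is processed at rate $s$. A (finite) input instance $\sigma$ consists of jobs $j$ with release times $a_j$ and sizes $w_j>0$. Preemption and migration are allowed, but a job may be processed by at most one server at any time. The cost of a schedule is $C=\int n(t)\,dt+\int\sum_{k=1}^m P(s_k(t))\,dt$, where $n(t)$ is the number of released, unfinished jobs at time $t$ and $s_k(t)$ is the speed of server $k$. An online algorithm learns of job $j$ only at time $a_j$. $\mathsf{OPT}$ denotes the offline optimal schedule, which knows $\sigma$ in advance and minimizes $C$. An online algorithm $A$ is $c$-competitive if $C_A(\sigma)\le c\,C_{\mathsf{OPT}}(\sigma)$ for every input instance $\sigma$. *)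

theory Defs
  imports "HOL-Analysis.Analysis"
begin

text \<open>
  Model.  Jobs are indexed by 0..<N with release times a j and sizes w j.
  There are m servers indexed by 0..<m.  A schedule is a pair (sp, asg):
  sp k t is the speed of server k at time t, and asg t k is the job
  (if any) that server k processes at time t.
\<close>

definition rate :: "nat \<Rightarrow> (nat \<Rightarrow> real \<Rightarrow> real) \<Rightarrow> (real \<Rightarrow> nat \<Rightarrow> nat option) \<Rightarrow> nat \<Rightarrow> real \<Rightarrow> real" where
  "rate m sp asg j t = (\<Sum>k<m. if asg t k = Some j then sp k t else 0)"

definition processed :: "(nat \<Rightarrow> real) \<Rightarrow> nat \<Rightarrow> (nat \<Rightarrow> real \<Rightarrow> real) \<Rightarrow> (real \<Rightarrow> nat \<Rightarrow> nat option) \<Rightarrow> nat \<Rightarrow> real \<Rightarrow> ennreal" where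
  "processed a m sp asg j t = (\<integral>\<^sup>+ s\<in>{a j..t}. ennreal (rate m sp asg j s) \<partial>lborel)"

definition unfinished :: "nat \<Rightarrow> (nat \<Rightarrow> real) \<Rightarrow> (nat \<Rightarrow> real) \<Rightarrow> nat \<Rightarrow> (nat \<Rightarrow> real \<Rightarrow> real) \<Rightarrow> (real \<Rightarrow> nat \<Rightarrow> nat option) \<Rightarrow> real \<Rightarrow> nat set" where
  "unfinished N a w m sp asg t = {j. j < N \<and> a j \<le> t \<and> processed a m sp asg j t < ennreal (w j)}"

definition num_alive :: "nat \<Rightarrow> (nat \<Rightarrow> real) \<Rightarrow> (nat \<Rightarrow> real) \<Rightarrow> nat \<Rightarrow> (nat \<Rightarrow> real \<Rightarrow> real) \<Rightarrow> (real \<Rightarrow> nat \<Rightarrow> nat option) \<Rightarrow> real \<Rightarrow> nat" where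
  "num_alive N a w m sp asg t = card (unfinished N a w m sp asg t)"

text \<open>Remaining size of job j at time t (meaningful for unfinished jobs).\<close>
definition remaining :: "(nat \<Rightarrow> real) \<Rightarrow> (nat \<Rightarrow> real) \<Rightarrow> nat \<Rightarrow> (nat \<Rightarrow> real \<Rightarrow> real) \<Rightarrow> (real \<Rightarrow> nat \<Rightarrow> nat option) \<Rightarrow> nat \<Rightarrow> real \<Rightarrow> real" where
  "remaining a w m sp asg j t = w j - enn2real (processed a m sp asg j t)"

definition feasible_schedule :: "nat \<Rightarrow> (nat \<Rightarrow> real) \<Rightarrow> nat \<Rightarrow> (nat \<Rightarrow> real \<Rightarrow> real) \<Rightarrow> (real \<Rightarrow> nat \<Rightarrow> nat option) \<Rightarrow> bool" where
  "feasible_schedule N a m sp asg \<longleftrightarrow>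
     (\<forall>k<m. \<forall>t. 0 \<le> sp k t) \<and>
     (\<forall>k<m. sp k \<in> borel_measurable borel) \<and>
     (\<forall>j<N. rate m sp asg j \<in> borel_measurable borel) \<and>
     (\<forall>t k1 k2 j. k1 < m \<longrightarrow> k2 < m \<longrightarrow> asg t k1 = Some j \<longrightarrow> asg t k2 = Some j \<longrightarrow> k1 = k2) \<and>
     (\<forall>t k j. k < m \<longrightarrow> asg t k = Some j \<longrightarrow> j < N \<and> a j \<le> t)"

definition cost :: "(real \<Rightarrow> real) \<Rightarrow> nat \<Rightarrow> (nat \<Rightarrow> real) \<Rightarrow> (nat \<Rightarrow> real) \<Rightarrow> nat \<Rightarrow> (nat \<Rightarrow> real \<Rightarrow> real) \<Rightarrow> (real \<Rightarrow> nat \<Rightarrow> nat option) \<Rightarrow> ennreal" where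
  "cost P N a w m sp asg =
     (\<integral>\<^sup>+ t. ennreal (real (num_alive N a w m sp asg t) + (\<Sum>k<m. P (sp k t))) \<partial>lborel)"

definition srpt_rule :: "real \<Rightarrow> nat \<Rightarrow> (nat \<Rightarrow> real) \<Rightarrow> (nat \<Rightarrow> real) \<Rightarrow> nat \<Rightarrow> (nat \<Rightarrow> real \<Rightarrow> real) \<Rightarrow> (real \<Rightarrow> nat \<Rightarrow> nat option) \<Rightarrow> bool" where
  "srpt_rule alpha N a w m sp asg \<longleftrightarrow>
     (\<forall>t. let U = unfinished N a w m sp asg t;
             S = {j. \<exists>k<m. asg t k = Some j};
             n = card U
          in S \<subseteq> U \<and> card S = min m n \<and>
             (\<forall>j\<in>S. \<forall>i\<in>U - S. remaining a w m sp asg j t \<le> remaining a w m sp asg i t) \<and>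
             (\<forall>k<m. sp k t = (if asg t k = None then 0
                               else if m \<le> n then (real n / real m) powr (1 / alpha) else 1)))"

end

theory Submission
  imports Defs
begin

text \<open>
  Fix a size level \<open>q\<close> and let \<open>D\<close> be the number of unfinished jobs with remaining size above \<open>q\<close>
  under SRPT minus the same number under the competing schedule. Arrivals leave \<open>D\<close> unchanged, an
  SRPT job crossing \<open>q\<close> decreases it, a job of the competitor crossing \<open>q\<close> increases it. With
  \<open>g l = \<alpha> (l/m) powr (1 - 1/\<alpha>)\<close> (zero for \<open>l \<le> 0\<close>), telescoping \<open>\<Sum>l\<le>D. g l\<close> over the crossings of
  \<open>q\<close> gives: the sum of \<open>g (n - m + 1 - n')\<close> over the SRPT crossings is at most the sum of \<open>g n\<close> over
  the competitor's crossings, where \<open>n, n'\<close> count unfinished jobs at the crossing time.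
  SRPT enters here: at most \<open>m\<close> jobs have remaining size at most that of a served one.

  Integrating over \<open>q\<close> turns crossings into work: if \<open>R, R'\<close> are the total rates spent on unfinished
  jobs, then \<open>\<integral> g (n - m + 1 - n') R \<le> \<integral> g n R'\<close>, and also \<open>\<integral> R \<le> \<integral> R'\<close>. SRPT pays \<open>2 n\<close> at each
  time, and Young's inequality yields pointwise
  \<open>2 n + 2 \<alpha> R' + 2 g n R' \<le> c (n' + \<Sum>P) + 2 \<alpha> R + 2 g (n - m + 1 - n') R\<close>
  already for \<open>c = max 4 (4 \<alpha> - 2)\<close>.
\<close>

subsection \<open>Counting crossings of a level\<close>

lemma sum_int_interval_bounds:
  fixes g :: "int \<Rightarrow> real"
  assumes "mono g" and "x \<le> y"
  shows "real_of_int (y - x) * g (x + 1) \<le> (\<Sum>l\<in>{x<..y}. g l)"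
    and "(\<Sum>l\<in>{x<..y}. g l) \<le> real_of_int (y - x) * g y"
proof -
  have c: "real (card {x<..y}) = real_of_int (y - x)" using assms by simp
  have "(\<Sum>l\<in>{x<..y}. g (x + 1)) \<le> (\<Sum>l\<in>{x<..y}. g l)"
    by (rule sum_mono) (use assms in \<open>simp add: monoD\<close>)
  then show "real_of_int (y - x) * g (x + 1) \<le> (\<Sum>l\<in>{x<..y}. g l)"
    using c by simp
  have "(\<Sum>l\<in>{x<..y}. g l) \<le> (\<Sum>l\<in>{x<..y}. g y)"
    by (rule sum_mono) (use assms in \<open>simp add: monoD\<close>)
  then show "(\<Sum>l\<in>{x<..y}. g l) \<le> real_of_int (y - x) * g y"
    using c by simp
qed

text \<open>\<open>f\<close> is a potential that starts at \<open>f 0 = 0\<close> and ends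
  nonnegative. At each time the \<open>u t\<close> falls of the running difference are handled
  before its \<open>v t\<close> rises. With \<open>d\<close> the value after both, the removed
  levels are all at least \<open>d - v t + 1\<close> and the added ones at most \<open>d\<close>, so
  monotonicity of \<open>g\<close> bounds both changes.\<close>

lemma jump_sum_le:
  fixes g :: "int \<Rightarrow> real" and u v :: "real \<Rightarrow> nat" and H K :: "real \<Rightarrow> real"
  assumes g: "mono g" "\<And>l. l \<le> 0 \<Longrightarrow> g l = 0" and fin: "finite E"
    and H: "\<And>t. t \<in> E \<Longrightarrow> u t > 0 \<Longrightarrow>
        H t \<le> g ((\<Sum>s\<in>{s\<in>E. s \<le> t}. int (v s) - int (u s)) - int (v t) + 1)"
    and K: "\<And>t. t \<in> E \<Longrightarrow> v t > 0 \<Longrightarrow>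
        g (\<Sum>s\<in>{s\<in>E. s \<le> t}. int (v s) - int (u s)) \<le> K t"
  shows "(\<Sum>t\<in>E. real (u t) * H t) \<le> (\<Sum>t\<in>E. real (v t) * K t)"
proof -
  define f where "f x = (\<Sum>l\<in>{0<..x}. g l)" for x :: int
  have nonneg: "g l \<ge> 0" for l
    using monoD[OF g(1), of "min l 0" l] g(2)[of "min l 0"] by simp
  have fdiff: "f y - f x = (\<Sum>l\<in>{x<..y}. g l)" if "x \<le> y" for x y
  proof -
    \<comment> \<open>The difference may become negative; levels below 1 contribute 0.\<close>
    have "(\<Sum>l\<in>{x<..y}. g l) = (\<Sum>l\<in>{0<..y} - {0<..x}. g l)"
    proof (rule sum.mono_neutral_right)
      show "\<forall>l\<in>{x<..y} - ({0<..y} - {0<..x}). g l = 0"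
        using that by (auto intro!: g(2))
    qed auto
    also have "\<dots> = f y - f x"
      unfolding f_def using that by (subst sum_diff) auto
    finally show ?thesis by simp
  qed
  have main: "f (\<Sum>s\<in>E. int (v s) - int (u s)) + (\<Sum>t\<in>E. real (u t) * H t)
      \<le> (\<Sum>t\<in>E. real (v t) * K t)"
    using fin H K
  proof (induction E rule: finite_linorder_max_induct)
    case empty
    then show ?case by (simp add: f_def)
  next
    case (insert b E)
    define d where "d = (\<Sum>s\<in>E. int (v s) - int (u s))"
    define d' where "d' = d + int (v b) - int (u b)"
    have "b \<notin> E" using insert.hyps by auto
    have full: "{s \<in> insert b E. s \<le> b} = insert b E" using insert.hyps by auto
    have sum_b: "(\<Sum>s\<in>insert b E. int (v s) - int (u s)) = d'"
      using insert.hyps \<open>b \<notin> E\<close> by (simp add: d_def d'_def)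
    have restr: "{s \<in> insert b E. s \<le> t} = {s \<in> E. s \<le> t}" if "t \<in> E" for t
      using insert.hyps that by force
    have IH: "f d + (\<Sum>t\<in>E. real (u t) * H t) \<le> (\<Sum>t\<in>E. real (v t) * K t)"
      unfolding d_def
    proof (rule insert.IH)
      fix t assume "t \<in> E"
      then show "u t > 0 \<Longrightarrow>
          H t \<le> g ((\<Sum>s\<in>{s\<in>E. s \<le> t}. int (v s) - int (u s)) - int (v t) + 1)"
        and "v t > 0 \<Longrightarrow> g (\<Sum>s\<in>{s\<in>E. s \<le> t}. int (v s) - int (u s)) \<le> K t"
        using insert.prems[of t] by (simp_all only: restr) simp_all
    qed
    have "real (u b) * H b \<le> f d - f (d - int (u b))"
    proof (cases "u b = 0")
      case False
      then have "H b \<le> g (d - int (u b) + 1)"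
        using insert.prems(1)[of b] unfolding full sum_b by (simp add: d'_def algebra_simps)
      then have "real (u b) * H b \<le> real_of_int (d - (d - int (u b))) * g (d - int (u b) + 1)"
        by (simp add: mult_left_mono)
      also have "\<dots> \<le> f d - f (d - int (u b))"
        using sum_int_interval_bounds(1)[OF g(1), of "d - int (u b)" d]
        by (simp add: fdiff)
      finally show ?thesis .
    qed simp
    moreover have "f d' - f (d - int (u b)) \<le> real (v b) * K b"
    proof (cases "v b = 0")
      case False
      have "f d' - f (d - int (u b)) \<le> real_of_int (d' - (d - int (u b))) * g d'"
        using sum_int_interval_bounds(2)[OF g(1), of "d - int (u b)" d']
        by (simp add: fdiff d'_def)
      also have "\<dots> = real (v b) * g d'" by (simp add: d'_def)
      also have "\<dots> \<le> real (v b) * K b"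
        using insert.prems(2)[of b] False unfolding full sum_b by (simp add: mult_left_mono)
      finally show ?thesis .
    qed (simp add: d'_def)
    ultimately show ?case
      unfolding sum_b using IH insert.hyps \<open>b \<notin> E\<close> by simp
  qed
  have "f (\<Sum>s\<in>E. int (v s) - int (u s)) \<ge> 0"
    unfolding f_def by (intro sum_nonneg nonneg)
  with main show ?thesis by simp
qed

text \<open>Grouping crossings by their time reduces this to \<open>jump_sum_le\<close>, with
  \<open>u\<close> and \<open>v\<close> the multiplicities of simultaneous crossings. In the
  application \<open>x\<close> holds the crossing times of SRPT and \<open>y\<close> those of the
  competitor.\<close>

lemma crossing_sum_le:
  fixes g :: "int \<Rightarrow> real" and x y :: "nat \<Rightarrow> real" and H K :: "real \<Rightarrow> real"
  assumes g: "mono g" "\<And>l. l \<le> 0 \<Longrightarrow> g l = 0" and fin: "finite I" "finite J"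
    and H: "\<And>i. i \<in> I \<Longrightarrow> H (x i) \<le> g (int (card {j\<in>J. y j \<le> x i})
        - int (card {j\<in>I. x j \<le> x i}) - int (card {j\<in>J. y j = x i}) + 1)"
    and K: "\<And>i. i \<in> J \<Longrightarrow> g (int (card {j\<in>J. y j \<le> y i}) - int (card {j\<in>I. x j \<le> y i})) \<le> K (y i)"
  shows "(\<Sum>i\<in>I. H (x i)) \<le> (\<Sum>j\<in>J. K (y j))"
proof -
  define E where "E = x ` I \<union> y ` J"
  define u where "u t = card {i\<in>I. x i = t}" for t
  define v where "v t = card {j\<in>J. y j = t}" for t
  have E: "finite E" "x ` I \<subseteq> E" "y ` J \<subseteq> E" using fin by (auto simp: E_def)
  have cnt: "(\<Sum>s\<in>{s\<in>E. s \<le> t}. card {i\<in>A. z i = s}) = card {i\<in>A. z i \<le> t}"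
    if "finite A" "z ` A \<subseteq> E" for t and A :: "nat set" and z
  proof -
    have "card {i\<in>A. z i \<le> t} = (\<Sum>s\<in>{s\<in>E. s \<le> t}. \<Sum>i\<in>{i\<in>{i\<in>A. z i \<le> t}. z i = s}. 1)"
      using that E(1) by (subst sum.group) auto
    also have "\<dots> = (\<Sum>s\<in>{s\<in>E. s \<le> t}. card {i\<in>A. z i = s})"
      by (intro sum.cong) (simp_all, metis (mono_tags, lifting))
    finally show ?thesis by simp
  qed
  have wsum: "(\<Sum>t\<in>E. real (card {i\<in>A. z i = t}) * F t) = (\<Sum>i\<in>A. F (z i))"
    if "finite A" "z ` A \<subseteq> E" for F :: "real \<Rightarrow> real" and A :: "nat set" and z
  proof -
    have "(\<Sum>i\<in>A. F (z i)) = (\<Sum>t\<in>E. \<Sum>i\<in>{i\<in>A. z i = t}. F (z i))"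
      using that E(1) by (subst sum.group) auto
    also have "\<dots> = (\<Sum>t\<in>E. real (card {i\<in>A. z i = t}) * F t)"
      by (intro sum.cong) auto
    finally show ?thesis by simp
  qed
  have D: "(\<Sum>s\<in>{s\<in>E. s \<le> t}. int (v s) - int (u s))
      = int (card {j\<in>J. y j \<le> t}) - int (card {i\<in>I. x i \<le> t})" for t
    unfolding sum_subtractf u_def v_def cnt[OF fin(1) E(2), symmetric] cnt[OF fin(2) E(3), symmetric]
    by simp
  have "(\<Sum>t\<in>E. real (u t) * H t) \<le> (\<Sum>t\<in>E. real (v t) * K t)"
  proof (rule jump_sum_le[OF g E(1)])
    fix t assume "t \<in> E" "u t > 0"
    then obtain i where "i \<in> I" "x i = t" by (fastforce simp: u_def card_gt_0_iff)
    with H[of i] show "H t \<le> g ((\<Sum>s\<in>{s\<in>E. s \<le> t}. int (v s) - int (u s)) - int (v t) + 1)"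
      unfolding D by (simp add: v_def)
  next
    fix t assume "t \<in> E" "v t > 0"
    then obtain i where "i \<in> J" "y i = t" by (fastforce simp: v_def card_gt_0_iff)
    with K[of i] show "g (\<Sum>s\<in>{s\<in>E. s \<le> t}. int (v s) - int (u s)) \<le> K t"
      unfolding D by simp
  qed
  then show ?thesis
    unfolding u_def v_def wsum[OF fin(1) E(2)] wsum[OF fin(2) E(3)] .
qed

subsection \<open>Work and crossing times of a single job\<close>

text \<open>\<open>finite_work\<close> keeps the remaining size faithful: \<open>enn2real\<close>
  sends infinity to 0, which would make a job look untouched.\<close>

locale workload =
  fixes \<rho> :: "real \<Rightarrow> real" and a w :: real
  assumes meas [measurable]: "\<rho> \<in> borel_measurable borel"
    and nonneg: "\<And>t. \<rho> t \<ge> 0"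
    and before: "\<And>t. t < a \<Longrightarrow> \<rho> t = 0"
    and size_pos: "0 < w"
    and finite_work: "\<And>t. (\<integral>\<^sup>+ s\<in>{a..t}. ennreal (\<rho> s) \<partial>lborel) < \<infinity>"
begin

text \<open>There is no truncation at 0: a schedule may keep processing a finished job, and
  \<open>rem\<close> then turns negative.\<close>

definition rem :: "real \<Rightarrow> real" where
  "rem t = w - enn2real (\<integral>\<^sup>+ s\<in>{a..t}. ennreal (\<rho> s) \<partial>lborel)"

definition cross :: "real \<Rightarrow> real" where
  "cross q = Inf {t. rem t \<le> q}"

text \<open>These are the levels strictly between 0 and \<open>w\<close> that are reached, so that
  \<open>cross q\<close> is the infimum of a nonempty set bounded below.\<close>

definition levels :: "real set" where
  "levels = {q. 0 < q \<and> q < w \<and> (\<exists>t. rem t \<le> q)}"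

lemma work_eq_rem: "(\<integral>\<^sup>+ s\<in>{a..t}. ennreal (\<rho> s) \<partial>lborel) = ennreal (w - rem t)"
  using finite_work[of t] by (simp add: rem_def)

lemma rem_le: "rem t \<le> w"
  by (simp add: rem_def)

lemma unfinished_iff: "(\<integral>\<^sup>+ s\<in>{a..t}. ennreal (\<rho> s) \<partial>lborel) < ennreal w \<longleftrightarrow> 0 < rem t"
  unfolding work_eq_rem using rem_le[of t] size_pos by (subst ennreal_less_iff) auto

lemma indicator_scale:
  "(\<integral>\<^sup>+ x. ennreal (indicat_real {a..t} x *\<^sub>R \<rho> x) \<partial>lborel) = (\<integral>\<^sup>+ s\<in>{a..t}. ennreal (\<rho> s) \<partial>lborel)"
  by (intro nn_integral_cong) (simp add: indicator_def)

lemma integrable: "set_integrable lborel {a..t} \<rho>"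
  unfolding set_integrable_def
proof (rule integrableI_nonneg)
  show "(\<integral>\<^sup>+ x. ennreal (indicat_real {a..t} x *\<^sub>R \<rho> x) \<partial>lborel) < \<infinity>"
    unfolding indicator_scale by (rule finite_work)
qed (auto simp: nonneg)

text \<open>The gauge integral gives access to continuity of the indefinite integral, hence of
  \<open>rem\<close>.\<close>

lemma rem_eq_integral: "rem t = w - integral {a..t} \<rho>"
proof -
  have "enn2real (\<integral>\<^sup>+ s\<in>{a..t}. ennreal (\<rho> s) \<partial>lborel) = (LINT s:{a..t}|lborel. \<rho> s)"
    unfolding set_lebesgue_integral_def
    by (subst integral_eq_nn_integral) (auto simp: nonneg indicator_scale[simplified])
  then show ?thesis
    using set_borel_integral_eq_integral(2)[OF integrable] by (simp add: rem_def)
qed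

lemma rem_early: "t \<le> a \<Longrightarrow> rem t = w"
  unfolding rem_eq_integral by (cases "t = a") auto

lemma rem_antimono: "s \<le> t \<Longrightarrow> rem t \<le> rem s"
  unfolding rem_def using finite_work[of t]
  by (auto intro!: enn2real_mono nn_integral_mono simp: indicator_def)

lemma continuous_rem: "continuous_on UNIV rem"
proof -
  have "isCont rem t" for t
  proof (cases "t < a")
    case True
    have "\<forall>\<^sub>F x in nhds t. rem x = w"
      using True rem_early by (auto simp: eventually_nhds intro!: exI[of _ "{..<a}"])
    then show ?thesis by (simp add: isCont_cong)
  next
    case False
    have "continuous_on {a..t + 1} (\<lambda>x. integral {a..x} \<rho>)"
      using set_borel_integral_eq_integral(1)[OF integrable]
      by (rule indefinite_integral_continuous_1)
    then have A: "continuous_on {a..t+1} rem"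
      unfolding rem_eq_integral[abs_def] by (intro continuous_intros)
    have "continuous_on {a - 1..a} rem"
      by (rule continuous_on_eq[of _ "\<lambda>_. w"]) (auto simp: rem_early)
    with A have "continuous_on ({a - 1..a} \<union> {a..t+1}) rem"
      by (intro continuous_on_closed_Un) auto
    then have "continuous_on {a - 1<..<t+1} rem"
      by (rule continuous_on_subset) auto
    then show ?thesis using False by (simp add: continuous_on_eq_continuous_at)
  qed
  then show ?thesis by (simp add: continuous_on_eq_continuous_at)
qed

lemma measurable_rem [measurable]: "rem \<in> borel_measurable borel"
  using continuous_rem by (rule borel_measurable_continuous_onI)

text \<open>By continuity the sublevel set is closed, and \<open>q < w\<close> bounds it below by
  \<open>a\<close>, so the infimum is attained; antitonicity makes the set a ray. The case
  \<open>q = 0\<close> is included and yields completion times.\<close>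

lemma cross_le_iff_gen:
  assumes "q < w" "rem t0 \<le> q"
  shows "cross q \<le> t \<longleftrightarrow> rem t \<le> q"
proof -
  let ?X = "{t. rem t \<le> q}"
  have "closed ?X" using continuous_rem by (intro closed_Collect_le) auto
  have bdd: "bdd_below ?X"
    by (rule bdd_belowI[of _ a]) (use assms rem_early in \<open>force intro: leI dest: less_imp_le\<close>)
  have "cross q \<in> ?X"
    unfolding cross_def using assms \<open>closed ?X\<close> bdd by (intro closed_contains_Inf) auto
  then show ?thesis
    using rem_antimono[of "cross q" t] bdd by (auto simp: cross_def intro!: cInf_lower)
qed

lemma cross_le_iff: "q \<in> levels \<Longrightarrow> cross q \<le> t \<longleftrightarrow> rem t \<le> q"
  using cross_le_iff_gen by (auto simp: levels_def)

lemma rem_cross: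
  assumes "q < w" "rem t0 \<le> q"
  shows "rem (cross q) = q"
proof (rule antisym)
  show "rem (cross q) \<le> q" using cross_le_iff_gen[OF assms, of "cross q"] by simp
  have "\<exists>x\<ge>min a t0. x \<le> t0 \<and> rem x = q"
    using assms continuous_rem rem_early[of "min a t0"]
    by (intro IVT2') (auto intro: continuous_on_subset)
  then obtain x where x: "rem x = q" by auto
  then have "cross q \<le> x" using cross_le_iff_gen[OF assms, of x] by simp
  then show "q \<le> rem (cross q)" using rem_antimono[of "cross q" x] x by simp
qed

lemma levels_iff: "q \<in> levels \<and> cross q \<le> t \<longleftrightarrow> 0 < q \<and> q < w \<and> rem t \<le> q"
  using cross_le_iff by (auto simp: levels_def)

lemma measurable_levels [measurable]: "levels \<in> sets borel"
proof -
  \<comment> \<open>Since \<open>rem\<close> is antitone, natural-number times suffice to detect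
    whether a level is reached.\<close>
  have "levels = (\<Union>n::nat. {q. 0 < q \<and> q < w \<and> rem (real n) \<le> q})"
    unfolding levels_def
  proof (intro set_eqI iffI)
    fix q assume "q \<in> {q. 0 < q \<and> q < w \<and> (\<exists>t. rem t \<le> q)}"
    then obtain t where t: "0 < q" "q < w" "rem t \<le> q" by auto
    obtain n :: nat where "t \<le> real n" using real_arch_simple by blast
    with t have "rem (real n) \<le> q" using rem_antimono order_trans by blast
    with t show "q \<in> (\<Union>n::nat. {q. 0 < q \<and> q < w \<and> rem (real n) \<le> q})" by auto
  qed auto
  then show ?thesis by simp
qed

lemma measurable_cross [measurable]: "cross \<in> borel_measurable (restrict_space lborel levels)"
proof (rule borel_measurableI_le)
  fix t
  have "{q \<in> space (restrict_space lborel levels). cross q \<le> t} = {q. 0 < q \<and> q < w \<and> rem t \<le> q} \<inter> levels"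
    using levels_iff by (auto simp: space_restrict_space)
  also have "\<dots> \<in> sets (restrict_space lborel levels)"
    unfolding sets_restrict_space
    by (rule image_eqI[where x = "{q. 0 < q \<and> q < w \<and> rem t \<le> q}"]) auto
  finally show "{q \<in> space (restrict_space lborel levels). cross q \<le> t} \<in> sets (restrict_space lborel levels)" .
qed

section \<open>Change of variables from time to remaining size\<close>

lemma work_until:
  "(\<integral>\<^sup>+ t. ennreal (\<rho> t) * indicator {t. 0 < rem t} t * indicator {..x} t \<partial>lborel)
     = ennreal (min w (w - rem x))"
proof (cases "0 < rem x")
  case True
  have "(\<integral>\<^sup>+ t. ennreal (\<rho> t) * indicator {t. 0 < rem t} t * indicator {..x} t \<partial>lborel)
      = (\<integral>\<^sup>+ t\<in>{a..x}. ennreal (\<rho> t) \<partial>lborel)"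
    using less_le_trans[OF True rem_antimono] before
    by (intro nn_integral_cong) (auto simp: indicator_def not_le)
  then show ?thesis using True by (simp add: work_eq_rem min_def)
next
  case False
  define c where "c = cross 0"
  have c: "c \<le> t \<longleftrightarrow> rem t \<le> 0" for t
    unfolding c_def using cross_le_iff_gen[of 0 x] size_pos False by auto
  have "rem c = 0" unfolding c_def using rem_cross[of 0 x] size_pos False by auto
  have "c \<le> x" using c False by simp
  \<comment> \<open>\<open>c\<close> is the completion time. Only at \<open>c\<close> itself may the
    integrands differ, because the job already counts as finished there; this is a null set.\<close>
  have "ennreal (\<rho> t) * indicator {t. 0 < rem t} t * indicator {..x} t
      = ennreal (\<rho> t) * indicator {a..c} t" if "t \<noteq> c" for t
    using c[of t] \<open>c \<le> x\<close> before[of t] that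
    by (cases "t < c"; cases "t < a") (auto simp: indicator_def)
  then have "(\<integral>\<^sup>+ t. ennreal (\<rho> t) * indicator {t. 0 < rem t} t * indicator {..x} t \<partial>lborel)
      = (\<integral>\<^sup>+ t\<in>{a..c}. ennreal (\<rho> t) \<partial>lborel)"
    using AE_lborel_singleton[of c] by (intro nn_integral_cong_AE) (auto elim: eventually_mono)
  then show ?thesis using False \<open>rem c = 0\<close> by (simp add: work_eq_rem min_def)
qed

text \<open>Both measures give the ray \<open>{..x}\<close> the mass
  \<open>min w (w - rem x)\<close>: on the left the length of the set of levels reached by time
  \<open>x\<close>, on the right the work done by then on the unfinished job. Rays form an
  intersection-stable generator.\<close>

lemma distr_cross:
  "distr (restrict_space lborel levels) borel cross
     = density lborel (\<lambda>t. ennreal (\<rho> t) * indicator {t. 0 < rem t} t)" (is "?M = ?N")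
proof (rule measure_eqI_generator_eq[where E = "range (\<lambda>x. {..x})" and \<Omega> = UNIV and A = "\<lambda>n. {..real n}"])
  show "Int_stable (range (\<lambda>x::real. {..x}))"
    by (auto simp: Int_stable_def)
  show "sets ?M = sigma_sets UNIV (range (\<lambda>x. {..x}))" "sets ?N = sigma_sets UNIV (range (\<lambda>x. {..x}))"
    by (simp_all add: borel_eq_atMost)
  have val: "emeasure ?M {..x} = ennreal (min w (w - rem x))" for x
  proof -
    have "emeasure ?M {..x} = emeasure lborel (cross -` {..x} \<inter> levels)"
      by (subst emeasure_distr) (auto simp: space_restrict_space emeasure_restrict_space)
    also have "cross -` {..x} \<inter> levels = {q. 0 < q \<and> q < w \<and> rem x \<le> q}"
      using levels_iff by auto
    also have "\<dots> = (if 0 < rem x then {rem x..<w} else {0<..<w})"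
      by auto
    finally show ?thesis using rem_le[of x] size_pos by auto
  qed
  show "emeasure ?M X = emeasure ?N X" if "X \<in> range (\<lambda>x. {..x})" for X
    using that work_until by (auto simp: val emeasure_density)
  show "emeasure ?M {..real n} \<noteq> \<infinity>" for n
    by (simp add: val)
qed (auto intro: real_arch_simple)

lemma measurable_comp_cross [measurable]:
  assumes "h \<in> borel_measurable borel"
  shows "(\<lambda>q. h (cross q) * indicator levels q :: ennreal) \<in> borel_measurable borel"
  using measurable_compose[OF measurable_cross assms]
  by (subst (asm) borel_measurable_restrict_space_iff_ennreal) auto

text \<open>The remaining size pushes the work measure \<open>\<rho> dt\<close> forward to Lebesgue measure on the levels
  it passes through.\<close>
lemma nn_integral_cross:
  assumes [measurable]: "h \<in> borel_measurable borel"
  shows "(\<integral>\<^sup>+ q\<in>levels. h (cross q) \<partial>lborel)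
     = (\<integral>\<^sup>+ t. ennreal (\<rho> t) * indicator {t. 0 < rem t} t * h t \<partial>lborel)"
proof -
  have "(\<integral>\<^sup>+ q\<in>levels. h (cross q) \<partial>lborel) = (\<integral>\<^sup>+ t. h t \<partial>distr (restrict_space lborel levels) borel cross)"
    by (subst nn_integral_distr) (auto simp: nn_integral_restrict_space)
  then show ?thesis
    by (simp add: distr_cross nn_integral_density)
qed

text \<open>The density \<open>\<rho>\<close> gives no mass to times of rate 0, and
  \<open>distr_cross\<close> carries this back to levels. Under SRPT it says that a job is being
  served when it crosses almost any level.\<close>

lemma AE_cross_rate_pos: "AE q in lborel. q \<in> levels \<longrightarrow> 0 < \<rho> (cross q)"
proof -
  have "AE t in distr (restrict_space lborel levels) borel cross. 0 < \<rho> t"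
    unfolding distr_cross by (subst AE_density) (auto simp: nonneg indicator_def order_less_le)
  then show ?thesis
    by (subst (asm) AE_distr_iff) (auto simp: AE_restrict_space_iff)
qed

lemma total_work_le:
  "(\<integral>\<^sup>+ t. ennreal (\<rho> t) * indicator {t. 0 < rem t} t \<partial>lborel) \<le> ennreal w"
proof -
  have "(\<integral>\<^sup>+ t. ennreal (\<rho> t) * indicator {t. 0 < rem t} t \<partial>lborel) = (\<integral>\<^sup>+ q\<in>levels. 1 \<partial>lborel)"
    using nn_integral_cross[of "\<lambda>_. 1"] by simp
  also have "\<dots> \<le> (\<integral>\<^sup>+ q\<in>{0..w}. 1 \<partial>lborel)"
    by (intro nn_integral_mono) (auto simp: levels_def indicator_def)
  finally show ?thesis using size_pos by simp
qed

lemma total_work_ge: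
  assumes "rem t0 \<le> 0"
  shows "ennreal w \<le> (\<integral>\<^sup>+ t. ennreal (\<rho> t) * indicator {t. 0 < rem t} t \<partial>lborel)"
proof -
  have "ennreal w = (\<integral>\<^sup>+ t. ennreal (\<rho> t) * indicator {t. 0 < rem t} t * indicator {..t0} t \<partial>lborel)"
    unfolding work_until using assms size_pos by (simp add: min_def)
  also have "\<dots> \<le> (\<integral>\<^sup>+ t. ennreal (\<rho> t) * indicator {t. 0 < rem t} t \<partial>lborel)"
    by (intro nn_integral_mono) (auto simp: indicator_def)
  finally show ?thesis .
qed

end

subsection \<open>The pointwise inequality\<close>

text \<open>Young's inequality with exponents \<open>\<alpha>\<close> and
  \<open>\<alpha> / (\<alpha> - 1)\<close>: raising \<open>x powr (1 - 1 / \<alpha>)\<close> to the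
  second one returns \<open>x\<close>.\<close>

lemma Young_power:
  fixes \<alpha> s x :: real
  assumes "1 < \<alpha>" "0 \<le> s" "0 \<le> x"
  shows "\<alpha> * s * x powr (1 - 1 / \<alpha>) \<le> s powr \<alpha> + (\<alpha> - 1) * x"
proof -
  define b where "b = x powr (1 - 1 / \<alpha>)"
  have "(x powr (1 - 1 / \<alpha>)) powr (\<alpha> / (\<alpha> - 1)) = x"
    using assms by (simp add: powr_powr field_simps)
  then have "s * b \<le> s powr \<alpha> / \<alpha> + x / (\<alpha> / (\<alpha> - 1))"
    using Youngs_inequality[of \<alpha> "\<alpha> / (\<alpha> - 1)" s b] assms
    by (simp add: b_def field_simps)
  then have "\<alpha> * (s * b) \<le> \<alpha> * (s powr \<alpha> / \<alpha> + x / (\<alpha> / (\<alpha> - 1)))"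
    using assms by (intro mult_left_mono) auto
  also have "\<dots> = s powr \<alpha> + (\<alpha> - 1) * x"
    using assms by (simp add: field_simps)
  finally show ?thesis by (simp add: b_def mult.assoc)
qed

text \<open>This is the marginal power \<open>P'(P^-1(l / m))\<close> for
  \<open>P s = s powr \<alpha>\<close>, the function \<open>g\<close> of the overview. The argument
  is an integer because differences of job counts may be negative; the clamp gives 0 there, as
  \<open>0 powr x = 0\<close>.\<close>

definition marginal :: "real \<Rightarrow> nat \<Rightarrow> int \<Rightarrow> real" where
  "marginal \<alpha> m l = \<alpha> * (max 0 (real_of_int l) / real m) powr (1 - 1 / \<alpha>)"

lemma marginal_nonpos: "l \<le> 0 \<Longrightarrow> marginal \<alpha> m l = 0"
  by (simp add: marginal_def)

lemma marginal_nonneg: "1 < \<alpha> \<Longrightarrow> 0 \<le> marginal \<alpha> m l"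
  by (simp add: marginal_def)

lemma mono_marginal: "1 < \<alpha> \<Longrightarrow> mono (marginal \<alpha> m)"
  unfolding marginal_def
  by (intro monoI mult_left_mono powr_mono2 divide_right_mono) (auto simp: field_simps)

text \<open>\<open>Young_power\<close> is summed over the servers in \<open>K\<close>, with
  \<open>x = 1\<close> for the first bound and \<open>x = n / m\<close> for the second.
  \<open>K\<close> stands for the servers on which the competitor processes unfinished jobs, so it
  has at most \<open>min m n'\<close> elements.\<close>

lemma optimum_rate_bounds:
  fixes s :: "nat \<Rightarrow> real" and n n' m :: nat
  assumes "1 < \<alpha>" "1 \<le> m" "\<And>k. k < m \<Longrightarrow> 0 \<le> s k" "K \<subseteq> {..<m}" "card K \<le> n'"
  shows "\<alpha> * (\<Sum>k\<in>K. s k) \<le> (\<Sum>k<m. s k powr \<alpha>) + (\<alpha> - 1) * real n'"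
    and "marginal \<alpha> m (int n) * (\<Sum>k\<in>K. s k)
      \<le> (\<Sum>k<m. s k powr \<alpha>) + (\<alpha> - 1) * (min (real m) (real n') * (real n / real m))"
proof -
  have fin: "finite K" using assms(4) finite_subset by blast
  have cK: "real (card K) \<le> min (real m) (real n')"
    using card_mono[OF _ assms(4)] assms(5) by simp
  have P: "(\<Sum>k\<in>K. s k powr \<alpha>) \<le> (\<Sum>k<m. s k powr \<alpha>)"
    using assms(4) by (intro sum_mono2) auto
  have gen: "\<alpha> * x powr (1 - 1 / \<alpha>) * (\<Sum>k\<in>K. s k)
      \<le> (\<Sum>k<m. s k powr \<alpha>) + (\<alpha> - 1) * (min (real m) (real n') * x)" if "0 \<le> x" for x
  proof -
    have "\<alpha> * x powr (1 - 1 / \<alpha>) * (\<Sum>k\<in>K. s k) = (\<Sum>k\<in>K. \<alpha> * s k * x powr (1 - 1 / \<alpha>))"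
      by (simp add: sum_distrib_left sum_distrib_right algebra_simps)
    also have "\<dots> \<le> (\<Sum>k\<in>K. s k powr \<alpha> + (\<alpha> - 1) * x)"
      using assms that by (intro sum_mono Young_power) auto
    also have "\<dots> = (\<Sum>k\<in>K. s k powr \<alpha>) + (\<alpha> - 1) * (real (card K) * x)"
      by (simp add: sum.distrib)
    also have "\<dots> \<le> (\<Sum>k<m. s k powr \<alpha>) + (\<alpha> - 1) * (min (real m) (real n') * x)"
      using P cK that assms(1) by (intro add_mono mult_left_mono mult_right_mono) auto
    finally show ?thesis .
  qed
  have "(\<alpha> - 1) * min (real m) (real n') \<le> (\<alpha> - 1) * real n'"
    using assms(1) by (intro mult_left_mono) auto
  then show "\<alpha> * (\<Sum>k\<in>K. s k) \<le> (\<Sum>k<m. s k powr \<alpha>) + (\<alpha> - 1) * real n'"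
    using gen[of 1] by simp
  show "marginal \<alpha> m (int n) * (\<Sum>k\<in>K. s k)
      \<le> (\<Sum>k<m. s k powr \<alpha>) + (\<alpha> - 1) * (min (real m) (real n') * (real n / real m))"
    using gen[of "real n / real m"] by (simp add: marginal_def)
qed

text \<open>With \<open>v\<close> the positive part of the argument divided by \<open>m\<close> and
  \<open>y = n / m\<close>, splitting \<open>v\<close> into powers \<open>1 / \<alpha>\<close> and
  \<open>1 - 1 / \<alpha>\<close> and using \<open>v \<le> y\<close> shows that the marginal term is
  at least \<open>\<alpha> * m * v\<close>. The rest of \<open>n - n'\<close> is at most
  \<open>m\<close>, which \<open>R \<ge> m\<close> covers.\<close>

lemma srpt_rate_bound:
  fixes n n' m :: nat
  assumes "1 < \<alpha>" "1 \<le> m" "m \<le> n"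
  defines "R \<equiv> real m * (real n / real m) powr (1 / \<alpha>)"
  shows "\<alpha> * (real n - real n') \<le> \<alpha> * R + marginal \<alpha> m (int n - int m + 1 - int n') * R"
proof -
  define y where "y = real n / real m"
  define v where "v = max 0 (real n - real m + 1 - real n') / real m"
  have y: "1 \<le> y" using assms by (simp add: y_def)
  have v: "0 \<le> v" "v \<le> y"
    using assms unfolding v_def y_def by (auto intro!: divide_right_mono)
  have "v \<le> y powr (1 / \<alpha>) * v powr (1 - 1 / \<alpha>)"
  proof -
    have "v = v powr (1 / \<alpha>) * v powr (1 - 1 / \<alpha>)"
      using v by (simp flip: powr_add)
    also have "\<dots> \<le> y powr (1 / \<alpha>) * v powr (1 - 1 / \<alpha>)"
      using v assms by (intro mult_right_mono powr_mono2) auto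
    finally show ?thesis .
  qed
  then have "\<alpha> * real m * v \<le> \<alpha> * real m * (y powr (1 / \<alpha>) * v powr (1 - 1 / \<alpha>))"
    using assms by (intro mult_left_mono) auto
  also have "\<dots> = marginal \<alpha> m (int n - int m + 1 - int n') * R"
    by (simp add: marginal_def R_def y_def v_def algebra_simps)
  finally have 1: "\<alpha> * real m * v \<le> marginal \<alpha> m (int n - int m + 1 - int n') * R" .
  have "1 \<le> y powr (1 / \<alpha>)" using y assms by (intro ge_one_powr_ge_zero) auto
  then have 2: "\<alpha> * real m \<le> \<alpha> * R"
    using assms(1,2) by (simp add: R_def y_def)
  have "real n - real n' \<le> real m + real m * v"
    using assms by (simp add: v_def)
  then have "\<alpha> * (real n - real n') \<le> \<alpha> * (real m + real m * v)"
    using assms by (intro mult_left_mono) auto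
  with 1 2 show ?thesis by (simp add: algebra_simps)
qed

lemma competitive_ratio_bounds:
  fixes \<alpha> :: real
  assumes "1 < \<alpha>" "\<alpha> < 2"
  shows "4 \<le> 3 + 2 / (2 - \<alpha>)" "4 * \<alpha> - 2 \<le> 3 + 2 / (2 - \<alpha>)"
proof -
  show "4 \<le> 3 + 2 / (2 - \<alpha>)" using assms by (simp add: field_simps)
  \<comment> \<open>For \<open>x = 2 - \<alpha>\<close> the goal reads
    \<open>(3 - 4 * x) * x \<le> 2\<close>; completing the square bounds the left side by
    \<open>9 / 16\<close>.\<close>
  have "0 \<le> (2 * (2 - \<alpha>) - 3 / 4)\<^sup>2" by simp
  then have "(4 * \<alpha> - 5) * (2 - \<alpha>) \<le> 2"
    using assms by (simp add: power2_eq_square algebra_simps)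
  then have "4 * \<alpha> - 5 \<le> 2 / (2 - \<alpha>)" using assms by (simp add: pos_le_divide_eq)
  then show "4 * \<alpha> - 2 \<le> 3 + 2 / (2 - \<alpha>)" by simp
qed

text \<open>Doubling the two Young bounds produces \<open>4 * P\<close>. If
  \<open>n \<ge> m\<close>, they also leave \<open>2 * (\<alpha> - 1) * n\<close>, which joins
  \<open>2 * n\<close> to form \<open>2 * \<alpha> * n\<close>; \<open>srpt_rate_bound\<close>
  trades this for \<open>2 * \<alpha> * n'\<close>, and \<open>n'\<close> ends up with coefficient
  \<open>4 * \<alpha> - 2\<close>. If \<open>n < m\<close>, then \<open>R = n\<close> and
  \<open>2 * \<alpha> * R\<close> absorbs \<open>2 * n\<close> directly.\<close>

lemma running_cost_bound:
  fixes s :: "nat \<Rightarrow> real" and n n' m :: nat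
  assumes \<alpha>: "1 < \<alpha>" "\<alpha> < 2" and m: "1 \<le> m" and s: "\<And>k. k < m \<Longrightarrow> 0 \<le> s k"
    and K: "K \<subseteq> {..<m}" "card K \<le> n'"
  defines "R \<equiv> if m \<le> n then real m * (real n / real m) powr (1 / \<alpha>) else real n"
    and "R' \<equiv> \<Sum>k\<in>K. s k"
  shows "2 * real n + 2 * \<alpha> * R' + 2 * (marginal \<alpha> m (int n) * R')
    \<le> (3 + 2 / (2 - \<alpha>)) * (real n' + (\<Sum>k<m. s k powr \<alpha>))
      + 2 * \<alpha> * R + 2 * (marginal \<alpha> m (int n - int m + 1 - int n') * R)"
proof -
  define P where "P = (\<Sum>k<m. s k powr \<alpha>)"
  have "P \<ge> 0" unfolding P_def by (intro sum_nonneg) auto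
  note c = competitive_ratio_bounds[OF \<alpha>]
  have c': "4 * P \<le> (3 + 2 / (2 - \<alpha>)) * P" "(4 * \<alpha> - 2) * real n' \<le> (3 + 2 / (2 - \<alpha>)) * real n'"
    using c \<open>P \<ge> 0\<close> by (intro mult_right_mono; simp)+
  have b: "\<alpha> * R' \<le> P + (\<alpha> - 1) * real n'"
    "marginal \<alpha> m (int n) * R' \<le> P + (\<alpha> - 1) * (min (real m) (real n') * (real n / real m))"
    unfolding R'_def P_def using \<alpha>(1) m s K by (rule optimum_rate_bounds; simp)+
  show ?thesis
  proof (cases "m \<le> n")
    case True
    have "min (real m) (real n') * (real n / real m) \<le> real m * (real n / real m)"
      by (intro mult_right_mono) auto
    then have "(\<alpha> - 1) * (min (real m) (real n') * (real n / real m)) \<le> (\<alpha> - 1) * real n"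
      using \<alpha> m by (intro mult_left_mono) auto
    then show ?thesis
      using b c' srpt_rate_bound[OF \<alpha>(1) m True, of n'] True
      by (simp add: R_def P_def algebra_simps)
  next
    case False
    have "min (real m) (real n') * (real n / real m) \<le> real n' * 1"
      using False m by (intro mult_mono) auto
    then have "(\<alpha> - 1) * (min (real m) (real n') * (real n / real m)) \<le> (\<alpha> - 1) * real n'"
      using \<alpha> by (intro mult_left_mono) auto
    moreover have "real n \<le> \<alpha> * real n" using \<alpha> by (simp add: mult_le_cancel_right1)
    moreover have "0 \<le> marginal \<alpha> m (int n - int m + 1 - int n') * real n"
      using marginal_nonneg \<alpha> by simp
    ultimately show ?thesis
      using b c' False by (simp add: R_def P_def algebra_simps)
  qed
qed

subsection \<open>Schedules\<close>

lemma rate_nonneg: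
  assumes "feasible_schedule N a m sp asg"
  shows "0 \<le> rate m sp asg j t"
  unfolding rate_def using assms by (intro sum_nonneg) (auto simp: feasible_schedule_def)

lemma rate_le_total:
  assumes "feasible_schedule N a m sp asg"
  shows "rate m sp asg j t \<le> (\<Sum>k<m. sp k t)"
  unfolding rate_def using assms by (intro sum_mono) (auto simp: feasible_schedule_def)

lemma sum_rate:
  assumes "finite A"
  shows "(\<Sum>j\<in>A. rate m sp asg j t) = (\<Sum>k\<in>{k. k < m \<and> asg t k \<in> Some ` A}. sp k t)"
proof -
  have "(\<Sum>j\<in>A. rate m sp asg j t) = (\<Sum>k<m. \<Sum>j\<in>A. if asg t k = Some j then sp k t else 0)"
    unfolding rate_def by (rule sum.swap)
  also have "\<dots> = (\<Sum>k<m. if asg t k \<in> Some ` A then sp k t else 0)"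
  proof (rule sum.cong)
    show "(\<Sum>j\<in>A. if asg t k = Some j then sp k t else 0)
        = (if asg t k \<in> Some ` A then sp k t else 0)" for k
      using assms by (cases "asg t k") (auto simp: sum.delta)
  qed simp
  also have "\<dots> = (\<Sum>k\<in>{k. k < m \<and> asg t k \<in> Some ` A}. sp k t)"
    by (rule sum.mono_neutral_cong_right) auto
  finally show ?thesis .
qed

text \<open>No job runs on two servers at once, so mapping a server to its job is injective.\<close>

lemma card_servers_le:
  assumes "feasible_schedule N a m sp asg" "finite A"
  shows "card {k. k < m \<and> asg t k \<in> Some ` A} \<le> card A"
proof (rule card_inj_on_le[where f = "\<lambda>k. the (asg t k)"])
  show "inj_on (\<lambda>k. the (asg t k)) {k. k < m \<and> asg t k \<in> Some ` A}"
    using assms by (fastforce simp: inj_on_def feasible_schedule_def)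
qed (use assms in auto)

lemma workload_schedule:
  assumes "feasible_schedule N a m sp asg" "j < N" "0 < w j"
    and "\<And>t. (\<integral>\<^sup>+ s\<in>{a j..t}. ennreal (\<Sum>k<m. sp k s) \<partial>lborel) < \<infinity>"
  shows "workload (rate m sp asg j) (a j) (w j)"
proof
  show "rate m sp asg j \<in> borel_measurable borel" "0 \<le> rate m sp asg j t" for t
    using assms rate_nonneg by (auto simp: feasible_schedule_def)
  show "rate m sp asg j t = 0" if "t < a j" for t
    unfolding rate_def using assms(1) that
    by (intro sum.neutral) (fastforce simp: feasible_schedule_def)
  show "(\<integral>\<^sup>+ s\<in>{a j..t}. ennreal (rate m sp asg j s) \<partial>lborel) < \<infinity>" for t
  proof (rule le_less_trans[OF _ assms(4)[of t]])
    show "(\<integral>\<^sup>+ s\<in>{a j..t}. ennreal (rate m sp asg j s) \<partial>lborel)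
        \<le> (\<integral>\<^sup>+ s\<in>{a j..t}. ennreal (\<Sum>k<m. sp k s) \<partial>lborel)"
      using rate_le_total[OF assms(1)]
      by (intro nn_integral_mono mult_right_mono ennreal_leI) auto
  qed
qed (use assms in auto)

text \<open>\<open>finite_speed\<close> is not part of feasibility. It is derived from bounded
  speeds for SRPT and from finite cost for the competitor.\<close>

locale schedule =
  fixes N m :: nat and a w :: "nat \<Rightarrow> real"
    and sp :: "nat \<Rightarrow> real \<Rightarrow> real" and asg :: "real \<Rightarrow> nat \<Rightarrow> nat option"
  assumes feasible: "feasible_schedule N a m sp asg"
    and sizes_pos: "\<And>j. j < N \<Longrightarrow> 0 < w j"
    and finite_speed: "\<And>j t. j < N \<Longrightarrow> (\<integral>\<^sup>+ s\<in>{a j..t}. ennreal (\<Sum>k<m. sp k s) \<partial>lborel) < \<infinity>"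
begin

abbreviation "\<rho> \<equiv> rate m sp asg"
abbreviation "U \<equiv> unfinished N a w m sp asg"
abbreviation "rm \<equiv> remaining a w m sp asg"
abbreviation "crs j \<equiv> workload.cross (\<rho> j) (a j) (w j)"
abbreviation "lvl j \<equiv> workload.levels (\<rho> j) (a j) (w j)"

lemma workload: "j < N \<Longrightarrow> workload (\<rho> j) (a j) (w j)"
  by (rule workload_schedule[where N = N]) (auto simp: feasible sizes_pos finite_speed[unfolded infinity_ennreal_def])

lemma rem_eq: "j < N \<Longrightarrow> workload.rem (\<rho> j) (a j) (w j) = rm j"
  by (simp add: fun_eq_iff workload.rem_def[OF workload] remaining_def processed_def)

lemma finite_U [simp]: "finite (U t)"
  by (rule finite_subset[of _ "{..<N}"]) (auto simp: unfinished_def)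

lemma U_iff: "j \<in> U t \<longleftrightarrow> j < N \<and> a j \<le> t \<and> 0 < rm j t"
  using workload.unfinished_iff[OF workload, of j t] rem_eq[of j]
  by (auto simp: unfinished_def processed_def)

lemma rate_before: "j < N \<Longrightarrow> t < a j \<Longrightarrow> \<rho> j t = 0"
  using workload.before[OF workload] .

lemma rm_before: "j < N \<Longrightarrow> t \<le> a j \<Longrightarrow> rm j t = w j"
  using workload.rem_early[OF workload] by (simp add: rem_eq)

lemma rm_le: "j < N \<Longrightarrow> rm j t \<le> w j"
  using workload.rem_le[OF workload] by (simp add: rem_eq)

lemma measurable_rm [measurable]: "j < N \<Longrightarrow> rm j \<in> borel_measurable borel"
  using workload.measurable_rem[OF workload] by (simp add: rem_eq)

lemma measurable_rate [measurable]: "j < N \<Longrightarrow> \<rho> j \<in> borel_measurable borel"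
  using workload.meas[OF workload] .

text \<open>The rate \<open>R\<close> or \<open>R'\<close> of the overview: effort on finished jobs
  is left out.\<close>

definition eff :: "real \<Rightarrow> real" where
  "eff t = (\<Sum>j\<in>U t. \<rho> j t)"

lemma eff_nonneg: "0 \<le> eff t"
  unfolding eff_def by (intro sum_nonneg rate_nonneg[OF feasible])

lemma eff_eq: "eff t = (\<Sum>j<N. \<rho> j t * indicator {t. 0 < rm j t} t)"
  unfolding eff_def
  by (rule sum.mono_neutral_cong_left) (auto simp: U_iff indicator_def rate_before not_le)

lemma measurable_eff [measurable]: "eff \<in> borel_measurable borel"
  unfolding eff_eq[abs_def] by measurable

lemma card_U_eq: "card (U t) = (\<Sum>j<N. if a j \<le> t \<and> 0 < rm j t then 1 else 0)"
  by (subst card_eq_sum, rule sum.mono_neutral_cong_left) (auto simp: U_iff)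

lemma measurable_card_U [measurable]: "(\<lambda>t. card (U t)) \<in> measurable borel (count_space UNIV)"
  unfolding card_U_eq by measurable

lemma nn_integral_eff:
  assumes [measurable]: "h \<in> borel_measurable borel"
  shows "(\<integral>\<^sup>+ t. ennreal (eff t) * h t \<partial>lborel)
    = (\<Sum>j<N. \<integral>\<^sup>+ t. ennreal (\<rho> j t) * indicator {t. 0 < rm j t} t * h t \<partial>lborel)"
proof -
  have "ennreal (eff t) * h t = (\<Sum>j<N. ennreal (\<rho> j t) * indicator {t. 0 < rm j t} t * h t)" for t
  proof -
    have "ennreal (eff t) = (\<Sum>j<N. ennreal (\<rho> j t * indicator {t. 0 < rm j t} t))"
      unfolding eff_eq by (rule sum_ennreal[symmetric]) (simp add: rate_nonneg[OF feasible])
    also have "\<dots> = (\<Sum>j<N. ennreal (\<rho> j t) * indicator {t. 0 < rm j t} t)"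
      by (intro sum.cong) (auto simp: indicator_def)
    finally show ?thesis by (simp only: sum_distrib_right)
  qed
  then show ?thesis by (simp, intro nn_integral_sum) auto
qed

text \<open>Applying \<open>nn_integral_cross\<close> to each job and exchanging sum and integral
  turns a work-weighted time integral into an integral over levels of a sum over crossings.\<close>

lemma nn_integral_eff_levels:
  assumes [measurable]: "h \<in> borel_measurable borel"
  shows "(\<integral>\<^sup>+ t. ennreal (eff t) * h t \<partial>lborel)
    = (\<integral>\<^sup>+ q. (\<Sum>j\<in>{j. j < N \<and> q \<in> lvl j}. h (crs j q)) \<partial>lborel)"
proof -
  have "(\<integral>\<^sup>+ t. ennreal (eff t) * h t \<partial>lborel) = (\<Sum>j<N. \<integral>\<^sup>+ q. h (crs j q) * indicator (lvl j) q \<partial>lborel)"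
    unfolding nn_integral_eff[OF assms]
    by (intro sum.cong) (simp_all add: workload.nn_integral_cross[OF workload] rem_eq)
  also have "\<dots> = (\<integral>\<^sup>+ q. (\<Sum>j<N. h (crs j q) * indicator (lvl j) q) \<partial>lborel)"
    by (rule nn_integral_sum[symmetric]) (simp add: workload.measurable_comp_cross[OF workload])
  also have "\<dots> = (\<integral>\<^sup>+ q. (\<Sum>j\<in>{j. j < N \<and> q \<in> lvl j}. h (crs j q)) \<partial>lborel)"
    by (intro nn_integral_cong sum.mono_neutral_cong_right) (auto simp: indicator_def)
  finally show ?thesis .
qed

lemma total_eff_le: "(\<integral>\<^sup>+ t. ennreal (eff t) \<partial>lborel) \<le> (\<Sum>j<N. ennreal (w j))"
  using nn_integral_eff[of "\<lambda>_. 1"] workload.total_work_le[OF workload]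
  by (auto simp: rem_eq intro!: sum_mono)

lemma total_eff_ge:
  assumes "\<And>j. j < N \<Longrightarrow> \<exists>t. rm j t \<le> 0"
  shows "(\<Sum>j<N. ennreal (w j)) \<le> (\<integral>\<^sup>+ t. ennreal (eff t) \<partial>lborel)"
proof -
  have "ennreal (w j) \<le> (\<integral>\<^sup>+ t. ennreal (\<rho> j t) * indicator {t. 0 < rm j t} t \<partial>lborel)" if "j < N" for j
    using assms[OF that] workload.total_work_ge[OF workload[OF that]] by (auto simp: rem_eq that)
  then show ?thesis
    using nn_integral_eff[of "\<lambda>_. 1"] by (auto intro!: sum_mono)
qed

lemma rm_crs: "j < N \<Longrightarrow> q \<in> lvl j \<Longrightarrow> rm j (crs j q) = q"
  using workload.rem_cross[OF workload, of j q] by (auto simp: workload.levels_def[OF workload] rem_eq)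

lemma crossed_iff:
  "j < N \<Longrightarrow> q \<in> lvl j \<and> crs j q \<le> t \<longleftrightarrow> 0 < q \<and> q < w j \<and> rm j t \<le> q"
  using workload.levels_iff[OF workload, of j q t] by (simp add: rem_eq)

lemma level_pos: "j < N \<Longrightarrow> q \<in> lvl j \<Longrightarrow> 0 < q"
  by (simp add: workload.levels_def[OF workload])

lemma crs_after: "j < N \<Longrightarrow> q \<in> lvl j \<Longrightarrow> a j \<le> crs j q"
  using rm_before[of j "crs j q"] rm_crs[of j q]
  by (force simp: workload.levels_def[OF workload] intro: leI dest: less_imp_le)

text \<open>At time \<open>t\<close> a job of size above \<open>q\<close> has either crossed
  \<open>q\<close>, or is unreleased, or is unfinished with more than \<open>q\<close> remaining.
  The counts of large and of unreleased jobs do not depend on the schedule, so they cancel when two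
  schedules are compared.\<close>

lemma card_crossed:
  assumes "0 < q"
  shows "int (card {j. j < N \<and> q \<in> lvl j \<and> crs j q \<le> t})
    = int (card {j. j < N \<and> q < w j}) - int (card {j. j < N \<and> t < a j \<and> q < w j}) - int (card {j\<in>U t. q < rm j t})"
proof -
  have crossed: "{j. j < N \<and> q \<in> lvl j \<and> crs j q \<le> t} = {j. j < N \<and> q < w j \<and> rm j t \<le> q}"
    using assms crossed_iff by blast
  let ?X = "{j. j < N \<and> q < w j \<and> rm j t \<le> q}" and ?Y = "{j. j < N \<and> t < a j \<and> q < w j}"
    and ?Z = "{j\<in>U t. q < rm j t}"
  have "{j. j < N \<and> q < w j} = ?X \<union> (?Y \<union> ?Z)"
    using assms rm_le by (force simp: U_iff not_le rm_before intro: less_le_trans)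
  moreover have "?X \<inter> (?Y \<union> ?Z) = {}" "?Y \<inter> ?Z = {}"
    by (auto simp: U_iff rm_before)
  ultimately have "card {j. j < N \<and> q < w j} = card ?X + (card ?Y + card ?Z)"
    by (simp add: card_Un_disjoint)
  then show ?thesis unfolding crossed by simp
qed

end

subsection \<open>SRPT against an arbitrary schedule\<close>

text \<open>\<open>Opt\<close> is an arbitrary competing schedule; optimality is not
  assumed.\<close>

locale srpt_comparison =
  Alg: schedule N m a w sp asg + Opt: schedule N m a w sp' asg'
  for N m :: nat and a w :: "nat \<Rightarrow> real"
    and sp sp' :: "nat \<Rightarrow> real \<Rightarrow> real" and asg asg' :: "real \<Rightarrow> nat \<Rightarrow> nat option" +
  fixes \<alpha> :: real
  assumes \<alpha>: "1 < \<alpha>" "\<alpha> < 2" and m: "1 \<le> m"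
    and srpt: "srpt_rule \<alpha> N a w m sp asg"
begin

abbreviation "n t \<equiv> card (Alg.U t)"
abbreviation "n' t \<equiv> card (Opt.U t)"

definition served :: "real \<Rightarrow> nat set" where
  "served t = {j. \<exists>k<m. asg t k = Some j}"

lemma srpt_at:
  "served t \<subseteq> Alg.U t \<and> card (served t) = min m (n t) \<and>
    (\<forall>j\<in>served t. \<forall>i\<in>Alg.U t - served t. Alg.rm j t \<le> Alg.rm i t) \<and>
    (\<forall>k<m. sp k t = (if asg t k = None then 0
      else if m \<le> n t then (real (n t) / real m) powr (1 / \<alpha>) else 1))"
  using srpt unfolding srpt_rule_def Let_def served_def by (rule spec)

lemma served_subset: "served t \<subseteq> Alg.U t"
  using srpt_at by simp

lemma card_served: "card (served t) = min m (n t)"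
  using srpt_at by simp

lemma served_shortest: "j \<in> served t \<Longrightarrow> i \<in> Alg.U t - served t \<Longrightarrow> Alg.rm j t \<le> Alg.rm i t"
  using srpt_at[of t] by simp

lemma speed: "k < m \<Longrightarrow> sp k t = (if asg t k = None then 0
    else if m \<le> n t then (real (n t) / real m) powr (1 / \<alpha>) else 1)"
  using srpt_at[of t] by simp

lemma finite_served [simp]: "finite (served t)"
  by (rule finite_subset[OF served_subset]) simp

lemma served_if_rate_pos:
  assumes "0 < Alg.\<rho> j t"
  shows "j \<in> served t"
proof (rule ccontr)
  assume "j \<notin> served t"
  then have "Alg.\<rho> j t = 0" by (auto simp: rate_def served_def intro!: sum.neutral)
  with assms show False by simp
qed

definition busy :: "real \<Rightarrow> nat set" where
  "busy t = {k. k < m \<and> asg t k \<noteq> None}"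

lemma card_busy: "card (busy t) = min m (n t)"
proof -
  have "bij_betw (\<lambda>k. the (asg t k)) (busy t) (served t)"
  proof (rule bij_betw_imageI)
    have "k1 = k2" if "k1 < m" "k2 < m" "asg t k1 = Some j" "asg t k2 = Some j" for k1 k2 j
      using Alg.feasible that unfolding feasible_schedule_def by blast
    then show "inj_on (\<lambda>k. the (asg t k)) (busy t)"
      by (auto simp: inj_on_def busy_def)
    show "(\<lambda>k. the (asg t k)) ` busy t = served t"
      by (force simp: busy_def served_def)
  qed
  then show ?thesis using card_served by (simp add: bij_betw_same_card)
qed

text \<open>All busy servers share one speed, and idle ones contribute \<open>f 0 = 0\<close>. It
  serves both for \<open>f\<close> the identity and for the power function.\<close>

lemma sum_busy:
  assumes "f 0 = 0"
  shows "(\<Sum>k<m. f (sp k t)) = (if m \<le> n t then real m * f ((real (n t) / real m) powr (1 / \<alpha>))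
      else real (n t) * f 1)"
proof -
  have "(\<Sum>k<m. f (sp k t)) = (\<Sum>k\<in>busy t. f (sp k t))"
    using assms by (intro sum.mono_neutral_right) (auto simp: busy_def speed)
  also have "\<dots> = (\<Sum>k\<in>busy t. f (if m \<le> n t then (real (n t) / real m) powr (1 / \<alpha>) else 1))"
    by (intro sum.cong) (auto simp: busy_def speed)
  finally show ?thesis using card_busy[of t] by auto
qed

lemma eff_eq_total: "Alg.eff t = (\<Sum>k<m. sp k t)"
proof -
  have "Alg.eff t = (\<Sum>k\<in>{k. k < m \<and> asg t k \<in> Some ` Alg.U t}. sp k t)"
    unfolding Alg.eff_def by (simp add: sum_rate)
  also have "\<dots> = (\<Sum>k<m. sp k t)"
  proof (rule sum.mono_neutral_left)
    show "\<forall>k\<in>{..<m} - {k. k < m \<and> asg t k \<in> Some ` Alg.U t}. sp k t = 0"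
    proof
      fix k assume k: "k \<in> {..<m} - {k. k < m \<and> asg t k \<in> Some ` Alg.U t}"
      then have "asg t k = None"
        using served_subset[of t] by (cases "asg t k") (auto simp: served_def)
      with k show "sp k t = 0" by (simp add: speed)
    qed
  qed auto
  finally show ?thesis .
qed

text \<open>The speed is chosen so that total power equals \<open>n t\<close>: \<open>m\<close>
  servers draw \<open>n / m\<close> each, or \<open>n\<close> servers draw 1 each. Hence the running
  cost is \<open>2 * n t\<close>.\<close>

lemma srpt_energy: "(\<Sum>k<m. sp k t powr \<alpha>) = real (n t)"
  using sum_busy[of "\<lambda>s. s powr \<alpha>" t] \<alpha> m by (simp add: powr_powr)

lemma running_cost:
  "2 * real (n t) + 2 * \<alpha> * Opt.eff t + 2 * (marginal \<alpha> m (int (n t)) * Opt.eff t)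
    \<le> (3 + 2 / (2 - \<alpha>)) * (real (n' t) + (\<Sum>k<m. sp' k t powr \<alpha>))
      + 2 * \<alpha> * Alg.eff t + 2 * (marginal \<alpha> m (int (n t) - int m + 1 - int (n' t)) * Alg.eff t)"
proof -
  have "Opt.eff t = (\<Sum>k\<in>{k. k < m \<and> asg' t k \<in> Some ` Opt.U t}. sp' k t)"
    unfolding Opt.eff_def by (simp add: sum_rate)
  moreover have "Alg.eff t = (if m \<le> n t then real m * (real (n t) / real m) powr (1 / \<alpha>) else real (n t))"
    unfolding eff_eq_total using sum_busy[of "\<lambda>s. s"] by simp
  ultimately show ?thesis
    using running_cost_bound[OF \<alpha> m, of "\<lambda>k. sp' k t" "{k. k < m \<and> asg' t k \<in> Some ` Opt.U t}" "n' t" "n t",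
        OF _ _ card_servers_le[OF Opt.feasible Opt.finite_U]] Opt.feasible
    by (simp add: feasible_schedule_def Collect_mono_iff lessThan_def)
qed

text \<open>At least \<open>n t - m\<close> jobs are unserved, and none of them is shorter than the
  served \<open>j\<close>. The second assumption rules out ties, making the comparison
  strict.\<close>

lemma unserved_longer:
  assumes "j \<in> served t" "\<And>i. i \<in> Alg.U t \<Longrightarrow> Alg.rm i t = Alg.rm j t \<Longrightarrow> i \<in> served t"
  shows "int (n t) - int m \<le> int (card {i\<in>Alg.U t. Alg.rm j t < Alg.rm i t})"
proof -
  have "Alg.U t - served t \<subseteq> {i\<in>Alg.U t. Alg.rm j t < Alg.rm i t}"
    using served_shortest[OF assms(1)] assms(2) by (force simp: order_less_le)
  then have "card (Alg.U t - served t) \<le> card {i\<in>Alg.U t. Alg.rm j t < Alg.rm i t}"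
    by (intro card_mono) auto
  moreover have "int (card (Alg.U t - served t)) = int (n t) - int (card (served t))"
    using served_subset[of t] card_mono[OF _ served_subset, of t] by (simp add: card_Diff_subset of_nat_diff)
  ultimately show ?thesis by (simp add: card_served)
qed

text \<open>Two kinds of levels are excluded, both negligible: those crossed while the rate vanishes, and
  those at which a job rests. A resting job attains its level at a rational time.\<close>
lemma level_inequality:
  assumes q: "\<And>j. j < N \<Longrightarrow> q \<in> Alg.lvl j \<Longrightarrow> 0 < Alg.\<rho> j (Alg.crs j q)"
    and no_rest: "\<And>j x. j < N \<Longrightarrow> x \<in> \<rat> \<Longrightarrow> Alg.rm j x \<noteq> q"
  shows "(\<Sum>j\<in>{j. j < N \<and> q \<in> Alg.lvl j}.
            marginal \<alpha> m (int (n (Alg.crs j q)) - int m + 1 - int (n' (Alg.crs j q))))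
       \<le> (\<Sum>j\<in>{j. j < N \<and> q \<in> Opt.lvl j}. marginal \<alpha> m (int (n (Opt.crs j q))))"
proof (cases "0 < q")
  case True
  have mono: "x \<le> y \<Longrightarrow> marginal \<alpha> m x \<le> marginal \<alpha> m y" for x y
    using mono_marginal[OF \<alpha>(1), of m] by (rule monoD)
  let ?I = "{j. j < N \<and> q \<in> Alg.lvl j}" and ?J = "{j. j < N \<and> q \<in> Opt.lvl j}"
  \<comment> \<open>This is the difference \<open>D\<close> of the overview, read off from
    crossings; the schedule-independent counts cancel.\<close>
  have cnt: "int (card {j\<in>?J. Opt.crs j q \<le> t}) - int (card {j\<in>?I. Alg.crs j q \<le> t})
      = int (card {j\<in>Alg.U t. q < Alg.rm j t}) - int (card {j\<in>Opt.U t. q < Opt.rm j t})" for t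
    using Alg.card_crossed[OF True, of t] Opt.card_crossed[OF True, of t] by (simp add: conj_assoc)
  show ?thesis
  proof (rule crossing_sum_le[where g = "marginal \<alpha> m" and x = "\<lambda>j. Alg.crs j q" and y = "\<lambda>j. Opt.crs j q"
        and H = "\<lambda>t. marginal \<alpha> m (int (n t) - int m + 1 - int (n' t))"
        and K = "\<lambda>t. marginal \<alpha> m (int (n t))"])
    fix j assume j: "j \<in> ?I"
    define t where "t = Alg.crs j q"
    have rj: "Alg.rm j t = q" using j by (simp add: t_def Alg.rm_crs)
    have "j \<in> served t" using j q by (auto simp: t_def intro: served_if_rate_pos)
    moreover have "i \<in> served t" if i: "i \<in> Alg.U t" "Alg.rm i t = q" for i
    proof -
      have iN: "i < N" using i by (simp add: Alg.U_iff)
      \<comment> \<open>A job of size exactly \<open>q\<close> would sit at \<open>q\<close> before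
        its release, in particular at a rational time.\<close>
      have "w i \<noteq> q"
      proof -
        obtain x where "x \<in> \<rat>" "x < a i"
          using Rats_dense_in_real[of "a i - 1" "a i"] by auto
        then show ?thesis using no_rest[OF iN] Alg.rm_before[OF iN, of x] by force
      qed
      then have "q < w i" using Alg.rm_le[OF iN, of t] i by simp
      then have lvl: "q \<in> Alg.lvl i" "Alg.crs i q \<le> t"
        using Alg.crossed_iff[OF iN, of q t] True i by auto
      \<comment> \<open>Had \<open>i\<close> reached \<open>q\<close> earlier, it would rest there
        throughout an interval, which contains a rational time. So \<open>i\<close> crosses
        \<open>q\<close> exactly at \<open>t\<close>, with positive rate, and is therefore
        served.\<close>
      have "Alg.crs i q = t"
      proof (rule ccontr)
        assume "Alg.crs i q \<noteq> t"
        with lvl obtain x where x: "x \<in> \<rat>" "Alg.crs i q < x" "x < t"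
          using Rats_dense_in_real[of "Alg.crs i q" t] by auto
        have "Alg.rm i x \<le> q" using Alg.crossed_iff[OF iN, of q x] lvl x by auto
        moreover have "q \<le> Alg.rm i x"
          using workload.rem_antimono[OF Alg.workload[OF iN], of x t] x i by (simp add: Alg.rem_eq iN)
        ultimately show False using no_rest[OF iN x(1)] by simp
      qed
      then show ?thesis using q[OF iN lvl(1)] served_if_rate_pos by simp
    qed
    ultimately have 1: "int (n t) - int m \<le> int (card {i\<in>Alg.U t. q < Alg.rm i t})"
      using unserved_longer[of j t] rj by simp
    \<comment> \<open>The competitor's jobs crossing \<open>q\<close> at time \<open>t\<close> have
      exactly \<open>q > 0\<close> left, so they are still unfinished and disjoint from those above
      \<open>q\<close>. This pays for the simultaneous rises subtracted in
      \<open>crossing_sum_le\<close>.\<close>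
    have "card ({i\<in>Opt.U t. q < Opt.rm i t} \<union> {i\<in>?J. Opt.crs i q = t}) \<le> n' t"
      using Opt.rm_crs Opt.crs_after True by (intro card_mono) (auto simp: Opt.U_iff)
    moreover have "{i\<in>Opt.U t. q < Opt.rm i t} \<inter> {i\<in>?J. Opt.crs i q = t} = {}"
      using Opt.rm_crs by auto
    ultimately have 2: "card {i\<in>Opt.U t. q < Opt.rm i t} + card {i\<in>?J. Opt.crs i q = t} \<le> n' t"
      by (simp add: card_Un_disjoint)
    show "marginal \<alpha> m (int (n (Alg.crs j q)) - int m + 1 - int (n' (Alg.crs j q)))
        \<le> marginal \<alpha> m (int (card {i\<in>?J. Opt.crs i q \<le> Alg.crs j q})
          - int (card {i\<in>?I. Alg.crs i q \<le> Alg.crs j q}) - int (card {i\<in>?J. Opt.crs i q = Alg.crs j q}) + 1)"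
      unfolding cnt t_def[symmetric] by (rule mono) (use 1 2 in linarith)
  next
    fix j assume "j \<in> ?J"
    have "card {i\<in>Alg.U t. q < Alg.rm i t} \<le> n t" for t by (intro card_mono) auto
    note le = this[of "Opt.crs j q"]
    show "marginal \<alpha> m (int (card {i\<in>?J. Opt.crs i q \<le> Opt.crs j q})
          - int (card {i\<in>?I. Alg.crs i q \<le> Opt.crs j q})) \<le> marginal \<alpha> m (int (n (Opt.crs j q)))"
      unfolding cnt by (rule mono) (use le in linarith)
  qed (auto simp: mono_marginal \<alpha> marginal_nonpos)
next
  case False
  then have "{j. j < N \<and> q \<in> Alg.lvl j} = {}" using Alg.level_pos by auto
  then show ?thesis by (simp only: sum.empty) (intro sum_nonneg marginal_nonneg \<alpha>)
qed

lemma measurable_weights [measurable]: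
  "(\<lambda>t. marginal \<alpha> m (int (n t))) \<in> borel_measurable borel"
  "(\<lambda>t. marginal \<alpha> m (int (n t) - int m + 1 - int (n' t))) \<in> borel_measurable borel"
  unfolding marginal_def by simp_all

text \<open>\<open>level_inequality\<close> holds for almost every \<open>q\<close>; integrating it
  over \<open>q\<close> and changing variables back to time gives the claim.\<close>

lemma weighted_work_le:
  "(\<integral>\<^sup>+ t. ennreal (Alg.eff t) * ennreal (marginal \<alpha> m (int (n t) - int m + 1 - int (n' t))) \<partial>lborel)
    \<le> (\<integral>\<^sup>+ t. ennreal (Opt.eff t) * ennreal (marginal \<alpha> m (int (n t))) \<partial>lborel)"
proof -
  have "AE q in lborel. \<forall>j\<in>{..<N}. q \<in> Alg.lvl j \<longrightarrow> 0 < Alg.\<rho> j (Alg.crs j q)"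
    using workload.AE_cross_rate_pos[OF Alg.workload] by (intro AE_finite_allI) auto
  moreover have "AE q in lborel. q \<notin> (\<Union>j\<in>{..<N}. Alg.rm j ` \<rat>)"
    by (intro AE_not_in countable_imp_null_set_lborel) (auto intro!: countable_UN countable_image countable_rat)
  ultimately have "AE q in lborel.
     (\<Sum>j\<in>{j. j < N \<and> q \<in> Alg.lvl j}.
        ennreal (marginal \<alpha> m (int (n (Alg.crs j q)) - int m + 1 - int (n' (Alg.crs j q)))))
       \<le> (\<Sum>j\<in>{j. j < N \<and> q \<in> Opt.lvl j}. ennreal (marginal \<alpha> m (int (n (Opt.crs j q)))))"
  proof eventually_elim
    case (elim q)
    have "(\<Sum>j\<in>{j. j < N \<and> q \<in> Alg.lvl j}.
            marginal \<alpha> m (int (n (Alg.crs j q)) - int m + 1 - int (n' (Alg.crs j q))))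
       \<le> (\<Sum>j\<in>{j. j < N \<and> q \<in> Opt.lvl j}. marginal \<alpha> m (int (n (Opt.crs j q))))"
      by (rule level_inequality) (use elim in auto)
    then show ?case
      by (simp only: sum_ennreal marginal_nonneg \<alpha>) (rule ennreal_leI)
  qed
  then have "(\<integral>\<^sup>+ q. (\<Sum>j\<in>{j. j < N \<and> q \<in> Alg.lvl j}.
        ennreal (marginal \<alpha> m (int (n (Alg.crs j q)) - int m + 1 - int (n' (Alg.crs j q))))) \<partial>lborel)
      \<le> (\<integral>\<^sup>+ q. (\<Sum>j\<in>{j. j < N \<and> q \<in> Opt.lvl j}.
        ennreal (marginal \<alpha> m (int (n (Opt.crs j q))))) \<partial>lborel)"
    by (rule nn_integral_mono_AE)
  then show ?thesis
    unfolding Alg.nn_integral_eff_levels[OF measurable_compose[OF measurable_weights(2) measurable_ennreal]]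
      Opt.nn_integral_eff_levels[OF measurable_compose[OF measurable_weights(1) measurable_ennreal]] .
qed

end

section \<open>Integration of the running cost inequality\<close>

text \<open>After integrating the pointwise inequality, the work terms \<open>W\<close> and
  \<open>V\<close> of SRPT are replaced by the larger \<open>W'\<close> and \<open>V'\<close>, which
  then cancel against the left side because they are finite.\<close>

lemma (in srpt_comparison) cost_le:
  assumes finish: "\<And>j. j < N \<Longrightarrow> \<exists>t. Opt.rm j t \<le> 0"
  shows "cost (\<lambda>s. s powr \<alpha>) N a w m sp asg
    \<le> ennreal (3 + 2 / (2 - \<alpha>)) * cost (\<lambda>s. s powr \<alpha>) N a w m sp' asg'"
proof -
  define c where "c = 3 + 2 / (2 - \<alpha>)"
  define F where "F t = real (n' t) + (\<Sum>k<m. sp' k t powr \<alpha>)" for t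
  define H where "H t = marginal \<alpha> m (int (n t) - int m + 1 - int (n' t))" for t
  define K where "K t = marginal \<alpha> m (int (n t))" for t
  define W where "W = (\<integral>\<^sup>+ t. ennreal (Alg.eff t) \<partial>lborel)"
  define W' where "W' = (\<integral>\<^sup>+ t. ennreal (Opt.eff t) \<partial>lborel)"
  define V where "V = (\<integral>\<^sup>+ t. ennreal (Alg.eff t) * ennreal (H t) \<partial>lborel)"
  define V' where "V' = (\<integral>\<^sup>+ t. ennreal (Opt.eff t) * ennreal (K t) \<partial>lborel)"
  have "0 \<le> c" using \<alpha> by (simp add: c_def)
  have nonneg: "0 \<le> F t" "0 \<le> H t" "0 \<le> K t" "0 \<le> Alg.eff t" "0 \<le> Opt.eff t" for t
    using \<alpha> Alg.eff_nonneg Opt.eff_nonneg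
    by (auto simp: F_def H_def K_def marginal_nonneg intro!: add_nonneg_nonneg sum_nonneg)
  have [measurable]: "H \<in> borel_measurable borel" "K \<in> borel_measurable borel"
    unfolding H_def K_def by measurable
  have [measurable]: "sp' k \<in> borel_measurable borel" if "k < m" for k
    using that Opt.feasible by (simp add: feasible_schedule_def)
  have [measurable]: "F \<in> borel_measurable borel"
    unfolding F_def by (intro borel_measurable_add borel_measurable_sum powr_real_measurable) auto
  \<comment> \<open>Work on unfinished jobs never exceeds the total size, and equals it when every
    job finishes.\<close>
  have "W \<le> (\<Sum>j<N. ennreal (w j))" "W' \<le> (\<Sum>j<N. ennreal (w j))" "(\<Sum>j<N. ennreal (w j)) \<le> W'"
    unfolding W_def W'_def using Alg.total_eff_le Opt.total_eff_le Opt.total_eff_ge[OF finish] by auto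
  then have WW: "W \<le> W'" "W' < \<infinity>"
    by (auto elim!: le_less_trans)
  have VV: "V \<le> V'"
    unfolding V_def V'_def H_def K_def by (rule weighted_work_le)
  \<comment> \<open>At most \<open>N\<close> jobs are unfinished, so the weight is bounded and
    \<open>V'\<close> inherits finiteness from \<open>W'\<close>.\<close>
  have "V' \<le> (\<integral>\<^sup>+ t. ennreal (marginal \<alpha> m (int N)) * ennreal (Opt.eff t) \<partial>lborel)"
    unfolding V'_def
  proof (rule nn_integral_mono)
    fix t
    have "n t \<le> N"
      using card_mono[of "{..<N}" "Alg.U t"] by (auto simp: unfinished_def)
    then have "K t \<le> marginal \<alpha> m (int N)"
      unfolding K_def using mono_marginal[OF \<alpha>(1), of m] by (simp add: monoD)
    then show "ennreal (Opt.eff t) * ennreal (K t) \<le> ennreal (marginal \<alpha> m (int N)) * ennreal (Opt.eff t)"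
      by (subst mult.commute) (intro mult_right_mono ennreal_leI, auto)
  qed
  also have "\<dots> = ennreal (marginal \<alpha> m (int N)) * W'"
    unfolding W'_def by (rule nn_integral_cmult) simp
  also have "\<dots> < \<infinity>" using WW(2) by (simp add: ennreal_mult_less_top)
  finally have V'_fin: "V' < \<infinity>" .
  have point: "ennreal (2 * n t) + (ennreal (2 * \<alpha>) * ennreal (Opt.eff t) + 2 * (ennreal (Opt.eff t) * ennreal (K t)))
      \<le> ennreal c * ennreal (F t) + (ennreal (2 * \<alpha>) * ennreal (Alg.eff t) + 2 * (ennreal (Alg.eff t) * ennreal (H t)))" for t
  proof -
    have two: "(2::ennreal) = ennreal 2" by simp
    have "2 * real (n t) + (2 * \<alpha> * Opt.eff t + 2 * (Opt.eff t * K t))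
        \<le> c * F t + (2 * \<alpha> * Alg.eff t + 2 * (Alg.eff t * H t))"
      using running_cost[of t] by (simp add: F_def H_def K_def c_def algebra_simps)
    from ennreal_leI[OF this] show ?thesis
      unfolding two using nonneg[of t] \<open>0 \<le> c\<close> \<alpha>
      by (simp add: ennreal_plus ennreal_mult del: ennreal_numeral)
  qed
  have "(\<integral>\<^sup>+ t. ennreal (2 * n t) \<partial>lborel) + (ennreal (2 * \<alpha>) * W' + 2 * V')
      = (\<integral>\<^sup>+ t. ennreal (2 * n t) + (ennreal (2 * \<alpha>) * ennreal (Opt.eff t) + 2 * (ennreal (Opt.eff t) * ennreal (K t))) \<partial>lborel)"
    unfolding W'_def V'_def by (simp add: nn_integral_add nn_integral_cmult)
  also have "\<dots> \<le> (\<integral>\<^sup>+ t. ennreal c * ennreal (F t) + (ennreal (2 * \<alpha>) * ennreal (Alg.eff t) + 2 * (ennreal (Alg.eff t) * ennreal (H t))) \<partial>lborel)"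
    by (intro nn_integral_mono point)
  also have "\<dots> = ennreal c * (\<integral>\<^sup>+ t. ennreal (F t) \<partial>lborel) + (ennreal (2 * \<alpha>) * W + 2 * V)"
    unfolding W_def V_def by (simp add: nn_integral_add nn_integral_cmult)
  also have "\<dots> \<le> ennreal c * (\<integral>\<^sup>+ t. ennreal (F t) \<partial>lborel) + (ennreal (2 * \<alpha>) * W' + 2 * V')"
    using WW VV by (intro add_mono mult_left_mono) auto
  finally have "(\<integral>\<^sup>+ t. ennreal (2 * n t) \<partial>lborel) \<le> ennreal c * (\<integral>\<^sup>+ t. ennreal (F t) \<partial>lborel)"
    using WW(2) V'_fin
    by (subst (asm) (1 2) add.commute)
       (simp add: ennreal_add_left_cancel_le ennreal_mult_eq_top_iff less_top[symmetric])
  moreover have "cost (\<lambda>s. s powr \<alpha>) N a w m sp asg = (\<integral>\<^sup>+ t. ennreal (2 * n t) \<partial>lborel)"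
    unfolding cost_def num_alive_def srpt_energy by (simp only: mult_2 of_nat_add)
  moreover have "cost (\<lambda>s. s powr \<alpha>) N a w m sp' asg' = (\<integral>\<^sup>+ t. ennreal (F t) \<partial>lborel)"
    unfolding cost_def num_alive_def F_def by (rule refl)
  ultimately show ?thesis by (simp only: c_def)
qed

section \<open>Finiteness of work and completion of all jobs\<close>

text \<open>Since \<open>s \<le> 1 + s powr \<alpha>\<close> for \<open>\<alpha> > 1\<close>, total
  speed on a bounded interval is dominated by a constant plus the energy.\<close>

lemma finite_work_of_finite_cost:
  assumes "1 < \<alpha>" "feasible_schedule N a m sp asg" "cost (\<lambda>s. s powr \<alpha>) N a w m sp asg < \<infinity>"
  shows "(\<integral>\<^sup>+ s\<in>{x..t}. ennreal (\<Sum>k<m. sp k s) \<partial>lborel) < \<infinity>"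
proof -
  let ?P = "\<lambda>s. \<Sum>k<m. sp k s powr \<alpha>"
  have [measurable]: "sp k \<in> borel_measurable borel" if "k < m" for k
    using that assms(2) by (simp add: feasible_schedule_def)
  have [measurable]: "?P \<in> borel_measurable borel"
    by (intro borel_measurable_sum powr_real_measurable) auto
  have P_nonneg: "0 \<le> ?P s" for s by (intro sum_nonneg) auto
  have "sp k s \<le> 1 + sp k s powr \<alpha>" for k s
  proof (cases "sp k s \<le> 1")
    case False
    then have "sp k s powr 1 \<le> sp k s powr \<alpha>" using assms(1) by (intro powr_mono) auto
    then show ?thesis using False by simp
  qed (simp add: add_increasing2)
  then have "(\<Sum>k<m. sp k s) \<le> (\<Sum>k<m. 1 + sp k s powr \<alpha>)" for s by (intro sum_mono) auto
  then have le: "(\<Sum>k<m. sp k s) \<le> real m + ?P s" for s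
    by (simp add: sum.distrib)
  have "(\<integral>\<^sup>+ s\<in>{x..t}. ennreal (\<Sum>k<m. sp k s) \<partial>lborel)
      \<le> (\<integral>\<^sup>+ s. ennreal (real m) * indicator {x..t} s + ennreal (?P s) \<partial>lborel)"
  proof (rule nn_integral_mono)
    fix s
    have "ennreal (\<Sum>k<m. sp k s) \<le> ennreal (real m) + ennreal (?P s)"
      using ennreal_leI[OF le[of s]] P_nonneg[of s] by (simp add: ennreal_plus)
    then show "ennreal (\<Sum>k<m. sp k s) * indicator {x..t} s
        \<le> ennreal (real m) * indicator {x..t} s + ennreal (?P s)"
      by (simp add: indicator_def)
  qed
  also have "\<dots> = (\<integral>\<^sup>+ s. ennreal (real m) * indicator {x..t} s \<partial>lborel) + (\<integral>\<^sup>+ s. ennreal (?P s) \<partial>lborel)"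
    by (rule nn_integral_add) auto
  also have "\<dots> \<le> (\<integral>\<^sup>+ s. ennreal (real m) * indicator {x..t} s \<partial>lborel) + cost (\<lambda>s. s powr \<alpha>) N a w m sp asg"
    unfolding cost_def by (intro add_left_mono nn_integral_mono ennreal_leI) simp
  also have "\<dots> < \<infinity>"
    using assms(3) by (simp add: nn_integral_cmult emeasure_lborel_Icc_eq ennreal_mult_less_top)
  finally show ?thesis .
qed

text \<open>At most \<open>N\<close> unfinished jobs bound every speed uniformly.\<close>

lemma finite_work_srpt:
  assumes "1 \<le> m" "1 < \<alpha>" "srpt_rule \<alpha> N a w m sp asg"
  shows "(\<integral>\<^sup>+ s\<in>{x..t}. ennreal (\<Sum>k<m. sp k s) \<partial>lborel) < \<infinity>"
proof -
  define C where "C = real m * (1 + (real N / real m) powr (1 / \<alpha>))"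
  have "(\<Sum>k<m. sp k s) \<le> C" for s
  proof -
    let ?n = "card (unfinished N a w m sp asg s)"
    have sp: "sp k s = (if asg s k = None then 0
        else if m \<le> ?n then (real ?n / real m) powr (1 / \<alpha>) else 1)" if "k < m" for k
      using assms(3) that unfolding srpt_rule_def Let_def by blast
    have "?n \<le> N"
      using card_mono[of "{..<N}" "unfinished N a w m sp asg s"] by (auto simp: unfinished_def)
    then have "(real ?n / real m) powr (1 / \<alpha>) \<le> (real N / real m) powr (1 / \<alpha>)"
      using assms by (intro powr_mono2 divide_right_mono) auto
    then have "sp k s \<le> 1 + (real N / real m) powr (1 / \<alpha>)" if "k < m" for k
      using sp[OF that] by (auto intro: add_increasing)
    then have "(\<Sum>k<m. sp k s) \<le> (\<Sum>k<m. 1 + (real N / real m) powr (1 / \<alpha>))"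
      by (intro sum_mono) auto
    then show ?thesis by (simp add: C_def)
  qed
  then have "(\<integral>\<^sup>+ s\<in>{x..t}. ennreal (\<Sum>k<m. sp k s) \<partial>lborel) \<le> (\<integral>\<^sup>+ s\<in>{x..t}. ennreal C \<partial>lborel)"
    by (intro nn_integral_mono mult_right_mono ennreal_leI) auto
  also have "\<dots> < \<infinity>"
    by (simp add: nn_integral_cmult emeasure_lborel_Icc_eq ennreal_mult_less_top)
  finally show ?thesis .
qed

text \<open>A job that never finishes adds at least 1 to the running cost at all times after its
  release.\<close>

lemma (in schedule) finishes_of_finite_cost:
  assumes "cost (\<lambda>s. s powr \<alpha>) N a w m sp asg < \<infinity>" "j < N"
  shows "\<exists>t. rm j t \<le> 0"
proof (rule ccontr)
  assume "\<nexists>t. rm j t \<le> 0"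
  then have alive: "j \<in> U t" if "a j \<le> t" for t
    using that assms(2) by (simp add: U_iff not_le)
  obtain r where r: "cost (\<lambda>s. s powr \<alpha>) N a w m sp asg = ennreal r" "0 \<le> r"
    using assms(1) by (cases "cost (\<lambda>s. s powr \<alpha>) N a w m sp asg") auto
  \<comment> \<open>An interval of length \<open>r + 1\<close> already forces more than the supposed
    cost \<open>r\<close>.\<close>
  have "ennreal (r + 1) = emeasure lborel {a j..a j + (r + 1)}"
    using r by simp
  also have "\<dots> = (\<integral>\<^sup>+ t. indicator {a j..a j + (r + 1)} t \<partial>lborel)"
    by simp
  also have "\<dots> \<le> cost (\<lambda>s. s powr \<alpha>) N a w m sp asg"
    unfolding cost_def
  proof (rule nn_integral_mono)
    fix t
    have "1 \<le> real (num_alive N a w m sp asg t) + (\<Sum>k<m. sp k t powr \<alpha>)" if "a j \<le> t"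
    proof -
      have "1 \<le> card (U t)" using alive[OF that] by (auto simp: Suc_le_eq card_gt_0_iff)
      moreover have "0 \<le> (\<Sum>k<m. sp k t powr \<alpha>)" by (intro sum_nonneg) auto
      ultimately show ?thesis by (simp add: num_alive_def)
    qed
    then show "indicator {a j..a j + (r + 1)} t
        \<le> ennreal (real (num_alive N a w m sp asg t) + (\<Sum>k<m. sp k t powr \<alpha>))"
      using ennreal_leI[of 1] by (auto simp: indicator_def)
  qed
  finally show False using r by simp
qed

theorem theorem2:
  fixes alpha :: real and m N :: nat and a w :: "nat \<Rightarrow> real"
    and sp sp' :: "nat \<Rightarrow> real \<Rightarrow> real" and asg asg' :: "real \<Rightarrow> nat \<Rightarrow> nat option"
  assumes "1 < alpha" and "alpha < 2" and "1 \<le> m"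
    and "\<forall>j<N. 0 < w j"
    and "feasible_schedule N a m sp asg"
    and "srpt_rule alpha N a w m sp asg"
    and "feasible_schedule N a m sp' asg'"
  shows "cost (\<lambda>s. s powr alpha) N a w m sp asg
           \<le> ennreal (3 + 2 / (2 - alpha)) * cost (\<lambda>s. s powr alpha) N a w m sp' asg'"
proof (cases "cost (\<lambda>s. s powr alpha) N a w m sp' asg' < \<infinity>")
  case True
  interpret srpt_comparison N m a w sp sp' asg asg' alpha
    using assms finite_work_srpt[OF assms(3,1,6)] finite_work_of_finite_cost[OF assms(1,7) True]
    by unfold_locales auto
  show ?thesis
    using Opt.finishes_of_finite_cost[OF True] by (rule cost_le)
next
  case False
  \<comment> \<open>A competitor of infinite cost makes the bound infinite, since the ratio is
    nonzero.\<close>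
  moreover have "ennreal (3 + 2 / (2 - alpha)) \<noteq> 0" using assms(1,2) by (simp add: add_pos_pos)
  ultimately show ?thesis by (simp add: ennreal_mult_eq_top_iff not_less top_unique)
qed

end
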